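(* The $(3,7)$-spectrum is the set of all even integers greater than or equal to $24$, that is, $\{24,26,28,30,\dots\}$. Its first element $24$ is equal to $N(3,7)$ and is larger than the Moore bound $M(3,7)$.
   Context: Graphs are finite and simple. For integers $k\ge 3$, $g\ge 3$, a $(k,g)$-graph is a $k$-regular graph of girth exactly $g$. The $(k,g)$-spectrum is the set of all integers $n$ such that there exists a connected $(k,g)$-graph of order $n$. For odd $k$, $N(k,g)$ denotes the smallest element $N$ of the $(k,g)$-spectrum such that all even integers $n\ge N$ belong to the $(k,g)$-spectrum. The Moore bound is $M(k,g)=1+\sum_{i=0}^{(g-3)/2}k(k-1)^i$ for $g$ odd and $M(k,g)=2\sum_{i=0}^{(g-2)/2}(k-1)^i$ for $g$ even. *)

theory Defs
  imports "Graph_Theory.Digraph_Component" "HOL-Library.Extended_Nat"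
begin

text \<open>
  A finite simple graph is a \<^locale>\<open>pair_graph\<close>: a finite, loopless, symmetric set of arcs
  given as ordered pairs of vertices, each edge being the two arcs \<open>(u,v)\<close> and \<open>(v,u)\<close>.
  Hence the number of edges at \<open>v\<close> is the out-degree of \<open>v\<close>.
\<close>

text \<open>
  The library's \<open>cycle\<close> counts the closed walk \<open>u,v,u\<close> along an edge and back as a cycle of
  length 2.  In a simple graph the bound \<open>3 \<le> length p\<close> removes exactly these walks.
  An acyclic graph has girth \<open>\<infinity>\<close>.
\<close>

definition girth :: "'a pair_pre_digraph \<Rightarrow> enat" where
  "girth G = (INF p \<in> {p. pre_digraph.cycle (with_proj G) p \<and> 3 \<le> length p}. enat (length p))"

definition regular :: "nat \<Rightarrow> 'a pair_pre_digraph \<Rightarrow> bool" where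
  "regular k G \<longleftrightarrow> (\<forall>v \<in> pverts G. out_degree (with_proj G) v = k)"

definition kg_graph :: "nat \<Rightarrow> nat \<Rightarrow> 'a pair_pre_digraph \<Rightarrow> bool" where
  "kg_graph k g G \<longleftrightarrow> pair_graph G \<and> regular k G \<and> girth G = enat g"

text \<open>
  Every finite graph is isomorphic to one whose vertices are natural numbers, so
  vertices of type \<^typ>\<open>nat\<close> lose no generality.
\<close>

definition kg_spectrum :: "nat \<Rightarrow> nat \<Rightarrow> nat set" where
  "kg_spectrum k g =
     {n. \<exists>G :: nat pair_pre_digraph.
           kg_graph k g G \<and> connected (with_proj G) \<and> card (pverts G) = n}"

text \<open>Intended for odd \<open>k\<close> only; unspecified if no such element exists.\<close>

definition spectrum_N :: "nat \<Rightarrow> nat \<Rightarrow> nat" where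
  "spectrum_N k g =
     (LEAST N. N \<in> kg_spectrum k g \<and> (\<forall>n \<ge> N. even n \<longrightarrow> n \<in> kg_spectrum k g))"

definition moore_bound :: "nat \<Rightarrow> nat \<Rightarrow> nat" where
  "moore_bound k g =
     (if odd g then 1 + (\<Sum>i = 0..(g - 3) div 2. k * (k - 1) ^ i)
      else 2 * (\<Sum>i = 0..(g - 2) div 2. (k - 1) ^ i))"

end

theory Submission
  imports Defs "HOL-Number_Theory.Cong"
begin

text \<open>
  Let \<open>G\<close> be a cubic graph of girth 7.  Counting edges shows that its order is even.  Girth at
  least 7 makes the non-backtracking walks of length at most 3 from a vertex end at pairwise
  different vertices, and there are \<open>1 + 3 + 6 + 12 = 22\<close> of them; this is the Moore bound.
  If the order were exactly 22, every vertex would be reached in this way.  A non-backtracking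
  walk of length 4 could then be closed, in exactly one way, to a cycle of length 7, so each of the
  22 vertices would be the start of 24 oriented 7-cycles, which makes \<open>22 * 24 = 528\<close> oriented
  7-cycles with a start vertex.  Rotating the start vertex splits these into classes of 7, but 7
  does not divide 528 (lemmas \<open>card_near\<close>, \<open>card_heptagons\<close>, \<open>dvd_card_rotation_closed\<close>).
  So the order is an even number that is at least 24.

  For the converse, graphs are given on the residues modulo \<open>n\<close>, the neighbours of \<open>x\<close> being
  \<open>x + d\<close> for three offsets \<open>d\<close> that depend on \<open>x\<close> only modulo a small \<open>c\<close>.  Walks in such a graph
  lift to the integers, so cycles shorter than 7 can be excluded for all \<open>n\<close> at once by
  enumerating the lifted non-backtracking walks of length 3 to 6 from the finitely many starting
  points \<open>0, \<dots>, c - 1\<close>: no displacement may be divisible by \<open>n\<close>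
  (\<open>nbwalks_lift\<close>, \<open>mem_kg_spectrum\<close>).
  For order 24 the McGee graph is used.  With \<open>m = n / 2\<close>, the I-graph \<open>I(m, 2, 3)\<close> serves for all
  even \<open>n \<ge> 26\<close> except 30 and 36, where it has an inner cycle of length 5 or 6; these two orders are
  realised by the generalised Petersen graphs \<open>I(15, 1, 4)\<close> and \<open>I(18, 1, 4)\<close>.
\<close>

section \<open>Cycles as cyclic lists of vertices\<close>

definition cyclic_list :: "'a rel \<Rightarrow> 'a list \<Rightarrow> bool" where
  "cyclic_list E xs \<longleftrightarrow>
     distinct xs \<and> (\<forall>i < length xs. (xs ! i, xs ! (Suc i mod length xs)) \<in> E)"

lemma pcas_iff_nth:
  assumes "p \<noteq> []"
  shows "pcas u p v \<longleftrightarrow> fst (p ! 0) = u \<and> snd (last p) = v \<and>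
    (\<forall>i. Suc i < length p \<longrightarrow> fst (p ! Suc i) = snd (p ! i))"
  using assms
proof (induction p arbitrary: u)
  case (Cons e p)
  show ?case
  proof (cases "p = []")
    case False
    obtain m where m: "length p = Suc m" using False by (cases p) auto
    have "(\<forall>i < length p. fst ((e # p) ! Suc i) = snd ((e # p) ! i)) \<longleftrightarrow>
        fst (p ! 0) = snd e \<and> (\<forall>i < m. fst (p ! Suc i) = snd (p ! i))"
      unfolding m All_less_Suc2 by simp
    then show ?thesis using Cons.IH[OF False] False by (auto simp: m)
  qed auto
qed simp

context pair_wf_digraph
begin

text \<open>
  A cycle is given as a list of arcs; the heads of its arcs form the corresponding cyclic list.
  Vertex lists are easier to write down explicitly, to count and to rotate.
\<close>

lemma cycle_of_length_iff:
  assumes "0 < L"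
  shows "(\<exists>p. cycle p \<and> length p = L) \<longleftrightarrow> (\<exists>xs. cyclic_list (parcs G) xs \<and> length xs = L)"
proof
  assume "\<exists>p. cycle p \<and> length p = L"
  then obtain p u where p: "awalk u p u" "distinct (tl (pawalk_verts u p))" "length p = L"
    by (auto simp: cycle_def)
  have ne: "p \<noteq> []" using p(3) assms by auto
  have cas: "pcas u p u" using p(1) by (simp add: awalk_def)
  note nth = cas[unfolded pcas_iff_nth[OF ne]]
  have "distinct (map snd p)"
    using p(2) ne awalk_verts_conv'[of u p u] cas by simp
  moreover have "(snd (p ! i), snd (p ! (Suc i mod L))) \<in> parcs G" if "i < L" for i
  proof -
    have "fst (p ! (Suc i mod L)) = snd (p ! i)"
    proof (cases "Suc i = L")
      case True
      then have "p ! i = last p" using p(3) ne by (metis diff_Suc_1 last_conv_nth)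
      then show ?thesis using nth True by simp
    next
      case False
      then show ?thesis using nth that p(3) by simp
    qed
    moreover have "p ! (Suc i mod L) \<in> parcs G"
      using p(1,3) assms by (auto simp: awalk_def)
    ultimately show ?thesis by (metis prod.collapse)
  qed
  ultimately have "cyclic_list (parcs G) (map snd p)"
    using p(3) assms by (auto simp: cyclic_list_def)
  then show "\<exists>xs. cyclic_list (parcs G) xs \<and> length xs = L" using p(3) by auto
next
  assume "\<exists>xs. cyclic_list (parcs G) xs \<and> length xs = L"
  then obtain xs where xs: "cyclic_list (parcs G) xs" "length xs = L" by blast
  define p where "p = map (\<lambda>i. (xs ! i, xs ! (Suc i mod L))) [0..<L]"
  have ne: "p \<noteq> []" and len: "length p = L" using assms by (auto simp: p_def)
  have "last p = (xs ! (L - 1), xs ! 0)"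
    using assms by (simp add: p_def last_map)
  moreover have "p ! i = (xs ! i, xs ! (Suc i mod L))" if "i < L" for i
    using that by (simp add: p_def)
  ultimately have cas: "pcas (xs ! 0) p (xs ! 0)"
    using assms by (auto simp: pcas_iff_nth[OF ne] len)
  have arcs: "set p \<subseteq> parcs G"
    using xs by (auto simp: p_def cyclic_list_def)
  then have "fst (p ! 0) \<in> pverts G"
    using len assms arc_fst_in_verts by (metis nth_mem subsetD)
  then have "awalk (xs ! 0) p (xs ! 0)"
    using cas arcs assms by (simp add: awalk_def p_def)
  moreover have "map snd p = rotate1 xs"
    using xs(2) assms by (intro nth_equalityI) (auto simp: p_def nth_rotate1)
  then have "distinct (tl (pawalk_verts (xs ! 0) p))"
    using awalk_verts_conv'[of "xs ! 0" p "xs ! 0"] cas ne xs(1) by (simp add: cyclic_list_def)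
  ultimately show "\<exists>p. cycle p \<and> length p = L"
    using ne len by (auto simp: cycle_def)
qed

end

lemma girth_eq_iff:
  assumes "pair_graph G" and "3 \<le> g"
  shows "girth G = enat g \<longleftrightarrow>
    (\<exists>xs. cyclic_list (parcs G) xs \<and> length xs = g) \<and>
    (\<forall>xs. cyclic_list (parcs G) xs \<longrightarrow> 3 \<le> length xs \<longrightarrow> g \<le> length xs)"
proof -
  interpret pair_graph G by fact
  define LS where "LS = {L. 3 \<le> L \<and> (\<exists>xs. cyclic_list (parcs G) xs \<and> length xs = L)}"
  have LS: "LS = {L. 3 \<le> L \<and> (\<exists>p. cycle p \<and> length p = L)}"
  proof -
    have "3 \<le> L \<and> (\<exists>xs. cyclic_list (parcs G) xs \<and> length xs = L) \<longleftrightarrow>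
        3 \<le> L \<and> (\<exists>p. cycle p \<and> length p = L)" for L
      using cycle_of_length_iff[of L] by (cases "3 \<le> L") auto
    then show ?thesis unfolding LS_def by simp
  qed
  have "girth G = Inf (enat ` LS)"
    unfolding girth_def LS by (rule arg_cong[of _ _ Inf]) auto
  moreover have "Inf (enat ` LS) = enat g \<longleftrightarrow> g \<in> LS \<and> (\<forall>L \<in> LS. g \<le> L)"
  proof
    assume eq: "Inf (enat ` LS) = enat g"
    then have ne: "LS \<noteq> {}" by (auto simp: top_enat_def)
    then have "Inf (enat ` LS) \<in> enat ` LS"
      by (metis ex_in_conv image_is_empty wellorder_InfI)
    then have "g \<in> LS" using eq by auto
    moreover have "g \<le> L" if "L \<in> LS" for L
      using eq that by (metis Inf_lower enat_ord_simps(1) image_eqI)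
    ultimately show "g \<in> LS \<and> (\<forall>L \<in> LS. g \<le> L)" by blast
  next
    assume "g \<in> LS \<and> (\<forall>L \<in> LS. g \<le> L)"
    then show "Inf (enat ` LS) = enat g"
      by (intro antisym Inf_lower Inf_greatest) auto
  qed
  ultimately show ?thesis using assms(2) by (auto simp: LS_def)
qed

section \<open>Two divisibility arguments\<close>

text \<open>
  A list of \<open>p\<close> distinct entries has \<open>p\<close> different rotations, exactly one of which starts with the
  least entry.  Hence \<open>S\<close> is in bijection with \<open>{..<p} \<times> S0\<close>, where \<open>S0\<close> collects the lists
  starting with their least entry.
\<close>

lemma dvd_card_rotation_closed:
  fixes S :: "'a::linorder list set"
  assumes fin: "finite S" and rot: "\<And>xs. xs \<in> S \<Longrightarrow> rotate1 xs \<in> S"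
    and dist: "\<And>xs. xs \<in> S \<Longrightarrow> distinct xs \<and> length xs = p" and "0 < p"
  shows "p dvd card S"
proof -
  define S0 where "S0 = {xs \<in> S. xs ! 0 = Min (set xs)}"
  have rotS: "rotate i xs \<in> S" if "xs \<in> S" for i xs
    using that by (induction i) (auto intro: rot simp: rotate_Suc)
  have "bij_betw (\<lambda>(i, xs). rotate i xs) ({..<p} \<times> S0) S"
  proof (rule bij_betw_imageI)
    \<comment> \<open>The amount of rotation can be read off from the position of the least entry.\<close>
    have pos: "(rotate i xs) ! ((p - i) mod p) = Min (set xs)" if "i < p" "xs \<in> S0" for i xs
    proof -
      have "length xs = p" "xs ! 0 = Min (set xs)" using that dist by (auto simp: S0_def)
      moreover have "(i + (p - i) mod p) mod p = 0"
        using \<open>i < p\<close> by (simp add: mod_add_right_eq)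
      ultimately show ?thesis using \<open>0 < p\<close> by (subst nth_rotate) auto
    qed
    show "inj_on (\<lambda>(i, xs). rotate i xs) ({..<p} \<times> S0)"
    proof (rule inj_onI, clarsimp)
      fix i xs j ys
      assume *: "i < p" "xs \<in> S0" "j < p" "ys \<in> S0" "rotate i xs = rotate j ys"
      then have "set xs = set ys" by (metis set_rotate)
      then have "(rotate i xs) ! ((p - i) mod p) = (rotate i xs) ! ((p - j) mod p)"
        using pos[OF *(1,2)] pos[OF *(3,4)] unfolding *(5) by metis
      moreover have "distinct (rotate i xs)" "length (rotate i xs) = p"
        using * dist by (auto simp: S0_def)
      ultimately have "(p - i) mod p = (p - j) mod p"
        using \<open>0 < p\<close> by (metis mod_less_divisor nth_eq_iff_index_eq)
      then have "i = j" using *(1,3) by (cases "i = 0"; cases "j = 0") auto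
      then show "i = j \<and> xs = ys"
        using *(5) inj_fn[OF inj_rotate1, of j] by (metis injD rotate_def)
    qed
    show "(\<lambda>(i, xs). rotate i xs) ` ({..<p} \<times> S0) = S"
    proof (intro equalityI subsetI)
      fix xs assume xs: "xs \<in> S"
      then have len: "length xs = p" using dist by blast
      then have "Min (set xs) \<in> set xs" using \<open>0 < p\<close> by (intro Min_in) auto
      then obtain i where i: "i < p" "xs ! i = Min (set xs)"
        using len by (auto simp: in_set_conv_nth)
      have "rotate i xs \<in> S0"
        using i len rotS[OF xs] \<open>0 < p\<close> nth_rotate[of 0 xs i] by (auto simp: S0_def)
      moreover have "rotate ((p - i) mod p) (rotate i xs) = xs"
      proof -
        have "((p - i) mod p + i) mod length xs = 0"
          using i(1) len by (simp add: mod_add_left_eq)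
        then show ?thesis by (simp add: rotate_rotate rotate_id)
      qed
      ultimately show "xs \<in> (\<lambda>(i, xs). rotate i xs) ` ({..<p} \<times> S0)"
        using \<open>0 < p\<close> by (intro image_eqI[of _ _ "((p - i) mod p, rotate i xs)"]) auto
    qed (auto simp: S0_def intro: rotS)
  qed
  then have "card S = card ({..<p} \<times> S0)" by (metis bij_betw_same_card)
  then show ?thesis by (simp add: card_cartesian_product)
qed

lemma even_card_symmetric:
  fixes E :: "'a::linorder rel"
  assumes "finite E" "sym E" "irrefl E"
  shows "even (card E)"
proof -
  define A where "A = {e \<in> E. fst e < snd e}"
  have "e \<in> A \<union> A\<inverse>" if "e \<in> E" for e
    using that assms(2,3) symD[OF assms(2), of "fst e" "snd e"]
    by (cases e; cases "fst e" "snd e" rule: linorder_cases) (simp_all add: A_def irrefl_def)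
  moreover have "A\<inverse> \<subseteq> E"
    using symD[OF assms(2)] by (auto simp: A_def)
  ultimately have "E = A \<union> A\<inverse>" by (auto simp: A_def)
  moreover have "finite A" using assms(1) by (simp add: A_def)
  moreover have "A \<inter> A\<inverse> = {}" by (auto simp: A_def)
  ultimately have "card E = card A + card (A\<inverse>)"
    by (metis card_Un_disjoint finite_converse)
  then show ?thesis by (simp add: card_inverse)
qed

section \<open>Cubic graphs without cycles shorter than 7\<close>

lemma cyclic_list_rotate1:
  assumes "cyclic_list E xs"
  shows "cyclic_list E (rotate1 xs)"
proof -
  have "(rotate1 xs ! i, rotate1 xs ! (Suc i mod length xs)) \<in> E" if "i < length xs" for i
  proof -
    have "0 < length xs" using that by linarith
    then have "Suc i mod length xs < length xs" by simp
    then show ?thesis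
      using assms that by (simp add: cyclic_list_def nth_rotate1)
  qed
  then show ?thesis using assms by (simp add: cyclic_list_def)
qed

lemma card_Sigma_const:
  assumes "finite A" "\<And>a. a \<in> A \<Longrightarrow> card (B a) = k" "0 < k"
  shows "card (Sigma A B) = k * card A"
proof -
  have "card (Sigma A B) = (\<Sum>a\<in>A. card (B a))"
    using assms by (intro card_SigmaI) (auto intro: card_ge_0_finite)
  then show ?thesis using assms(2) by simp
qed

locale cubic_girth_ge_7 =
  fixes V :: "'a::linorder set" and E :: "'a rel"
  assumes finite_V: "finite V"
    and E_sub: "E \<subseteq> V \<times> V"
    and sym: "sym E"
    and irrefl: "irrefl E"
    and cubic: "v \<in> V \<Longrightarrow> card (E `` {v}) = 3"
    and no_short_cycle: "cyclic_list E xs \<Longrightarrow> 3 \<le> length xs \<Longrightarrow> 7 \<le> length xs"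
begin

lemma adj_sym: "(a, b) \<in> E \<Longrightarrow> (b, a) \<in> E"
  using sym by (rule symD)

lemma adj_neq: "(a, b) \<in> E \<Longrightarrow> a \<noteq> b"
  using irrefl by (auto simp: irrefl_def)

text \<open>
  In the following lemmas only vertices two steps apart on the closed walk are assumed to differ.
  Vertices one step apart differ because there are no loops, and in walks of length 6 or 7 two equal
  vertices three steps apart would leave a triangle.
\<close>

lemma no_triangle:
  assumes "(a, b) \<in> E" "(b, c) \<in> E" "(c, a) \<in> E"
  shows False
proof -
  have "cyclic_list E [a, b, c]"
    using assms assms[THEN adj_neq] by (simp add: cyclic_list_def All_less_Suc2)
  then show False using no_short_cycle by fastforce
qed

lemma no_square:
  assumes "(a, b) \<in> E" "(b, c) \<in> E" "(c, d) \<in> E" "(d, a) \<in> E" and "a \<noteq> c" "b \<noteq> d"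
  shows False
proof -
  have "cyclic_list E [a, b, c, d]"
    using assms assms(1-4)[THEN adj_neq] by (simp add: cyclic_list_def All_less_Suc2)
  then show False using no_short_cycle by fastforce
qed

lemma no_pentagon:
  assumes "(a, b) \<in> E" "(b, c) \<in> E" "(c, d) \<in> E" "(d, e) \<in> E" "(e, a) \<in> E"
    and "a \<noteq> c" "b \<noteq> d" "c \<noteq> e" "d \<noteq> a" "e \<noteq> b"
  shows False
proof -
  have "cyclic_list E [a, b, c, d, e]"
    using assms assms(1-5)[THEN adj_neq] by (simp add: cyclic_list_def All_less_Suc2)
  then show False using no_short_cycle by fastforce
qed

lemma no_hexagon:
  assumes "(a, b) \<in> E" "(b, c) \<in> E" "(c, d) \<in> E" "(d, e) \<in> E" "(e, f) \<in> E" "(f, a) \<in> E"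
    and "a \<noteq> c" "b \<noteq> d" "c \<noteq> e" "d \<noteq> f" "e \<noteq> a" "f \<noteq> b"
  shows False
proof -
  have "a \<noteq> d" "b \<noteq> e" "c \<noteq> f"
    using assms(1-6) no_triangle by blast+
  then have "cyclic_list E [a, b, c, d, e, f]"
    using assms assms(1-6)[THEN adj_neq] by (simp add: cyclic_list_def All_less_Suc2)
  then show False using no_short_cycle by fastforce
qed

lemma cyclic_heptagonI:
  assumes "(a, b) \<in> E" "(b, c) \<in> E" "(c, d) \<in> E" "(d, e) \<in> E" "(e, f) \<in> E" "(f, g) \<in> E" "(g, a) \<in> E"
    and "a \<noteq> c" "b \<noteq> d" "c \<noteq> e" "d \<noteq> f" "e \<noteq> g" "f \<noteq> a" "g \<noteq> b"
  shows "cyclic_list E [a, b, c, d, e, f, g]"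
proof -
  have "a \<noteq> d" "b \<noteq> e" "c \<noteq> f" "d \<noteq> g" "e \<noteq> a" "f \<noteq> b" "g \<noteq> c"
    using assms(1-7) no_triangle by blast+
  then show ?thesis
    using assms assms(1-7)[THEN adj_neq] by (simp add: cyclic_list_def All_less_Suc2)
qed

lemma cyclic_heptagonD:
  assumes "cyclic_list E [a, b, c, d, e, f, g]"
  shows "(a, b) \<in> E" "(b, c) \<in> E" "(c, d) \<in> E" "(d, e) \<in> E" "(e, f) \<in> E" "(f, g) \<in> E" "(g, a) \<in> E"
    "distinct [a, b, c, d, e, f, g]"
  using assms by (simp_all add: cyclic_list_def All_less_Suc2)

text \<open>
  The sets \<open>walks2 v\<close>, \<open>walks3 v\<close> and \<open>walks4 v\<close> are the non-backtracking walks of the respective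
  length from \<open>v\<close>, with \<open>v\<close> itself left out.  The pairs are nested to the left so that each walk is
  a pair of a shorter walk and its last step, and cardinalities follow by iterating \<open>Sigma\<close>.
\<close>

definition walks2 :: "'a \<Rightarrow> ('a \<times> 'a) set" where
  "walks2 v = (SIGMA x:E `` {v}. E `` {x} - {v})"

definition walks3 :: "'a \<Rightarrow> (('a \<times> 'a) \<times> 'a) set" where
  "walks3 v = (SIGMA p:walks2 v. E `` {snd p} - {fst p})"

definition walks4 :: "'a \<Rightarrow> ((('a \<times> 'a) \<times> 'a) \<times> 'a) set" where
  "walks4 v = (SIGMA q:walks3 v. E `` {snd q} - {snd (fst q)})"

lemma mem_walks2: "(x, y) \<in> walks2 v \<longleftrightarrow> (v, x) \<in> E \<and> (x, y) \<in> E \<and> y \<noteq> v"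
  by (auto simp: walks2_def)

lemma mem_walks3: "((x, y), z) \<in> walks3 v \<longleftrightarrow> (x, y) \<in> walks2 v \<and> (y, z) \<in> E \<and> z \<noteq> x"
  by (auto simp: walks3_def)

lemma mem_walks4:
  "(((x, y), z), w) \<in> walks4 v \<longleftrightarrow> ((x, y), z) \<in> walks3 v \<and> (z, w) \<in> E \<and> w \<noteq> y"
  by (auto simp: walks4_def)

lemmas mem_walks = mem_walks2 mem_walks3 mem_walks4

lemma card_onward:
  assumes "(x, y) \<in> E"
  shows "card (E `` {y} - {x}) = 2"
  using assms E_sub adj_sym[OF assms] cubic[of y] by (auto simp: card_Diff_singleton)

lemma finite_nbrs: "finite (E `` {v})"
  by (rule finite_subset[OF _ finite_V]) (use E_sub in auto)

lemma card_walks: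
  assumes "v \<in> V"
  shows "card (walks2 v) = 6" "card (walks3 v) = 12" "card (walks4 v) = 24"
    "finite (walks2 v)" "finite (walks3 v)"
proof -
  show fin2: "finite (walks2 v)" unfolding walks2_def using finite_nbrs by auto
  then show fin3: "finite (walks3 v)" unfolding walks3_def using finite_nbrs by auto
  have "card (walks2 v) = 2 * card (E `` {v})"
    unfolding walks2_def using finite_nbrs by (intro card_Sigma_const card_onward) auto
  then show c2: "card (walks2 v) = 6" using cubic[OF assms] by simp
  have "card (walks3 v) = 2 * card (walks2 v)"
    unfolding walks3_def using fin2 by (intro card_Sigma_const card_onward) (auto simp: walks2_def)
  then show c3: "card (walks3 v) = 12" using c2 by simp
  have "card (walks4 v) = 2 * card (walks3 v)"
    unfolding walks4_def using fin3
    by (intro card_Sigma_const card_onward) (auto simp: walks3_def)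
  then show "card (walks4 v) = 24" using c3 by simp
qed

lemma inj_on_walks2: "inj_on snd (walks2 v)"
proof (rule inj_onI, clarsimp simp: mem_walks)
  fix x x' y
  assume "(v, x) \<in> E" "(x, y) \<in> E" "y \<noteq> v" "(v, x') \<in> E" "(x', y) \<in> E"
  then show "x = x'" using no_square[of v x y x'] adj_sym by blast
qed

text \<open>
  Two walks of length 3 from \<open>v\<close> with a common end form a closed hexagonal walk; it degenerates to
  a square if the walks share their first or their last inner vertex.
\<close>

lemma inj_on_walks3: "inj_on snd (walks3 v)"
proof (rule inj_onI, clarsimp simp: mem_walks)
  fix x y z x' y'
  assume *: "(v, x) \<in> E" "(x, y) \<in> E" "y \<noteq> v" "(y, z) \<in> E" "z \<noteq> x"
    "(v, x') \<in> E" "(x', y') \<in> E" "y' \<noteq> v" "(y', z) \<in> E" "z \<noteq> x'"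
  show "x = x' \<and> y = y'"
  proof (cases "x = x'")
    case True
    then show ?thesis using * no_square[of x y z y'] adj_sym by blast
  next
    case False
    then have "y \<noteq> y'" using * no_square[of v x y x'] adj_sym by blast
    then show ?thesis using * False no_hexagon[of v x y z y' x'] adj_sym by blast
  qed
qed

lemma mem_ends2: "z \<in> snd ` walks2 v \<longleftrightarrow> (\<exists>x. (v, x) \<in> E \<and> (x, z) \<in> E \<and> z \<noteq> v)"
  by (auto simp: image_iff Bex_def mem_walks)

lemma mem_ends3:
  "z \<in> snd ` walks3 v \<longleftrightarrow>
    (\<exists>x y. (v, x) \<in> E \<and> (x, y) \<in> E \<and> y \<noteq> v \<and> (y, z) \<in> E \<and> z \<noteq> x)"
  by (auto simp: image_iff Bex_def mem_walks)

definition near :: "'a \<Rightarrow> 'a set" where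
  "near v = {v} \<union> E `` {v} \<union> snd ` walks2 v \<union> snd ` walks3 v"

text \<open>
  A vertex that ends two walks of lengths \<open>i \<noteq> j \<le> 3\<close> would close a cycle of length at most
  \<open>i + j \<le> 5\<close>, so the four parts of \<open>near v\<close> are disjoint.
\<close>

lemma card_near:
  assumes "v \<in> V"
  shows "card (near v) = 22"
proof -
  have "({v} \<union> E `` {v}) \<inter> snd ` walks2 v = {}"
    using adj_sym no_triangle by (simp add: disjoint_iff mem_ends2 Image_singleton) blast
  moreover have "{v} \<inter> E `` {v} = {}" using adj_neq by auto
  moreover have "z \<notin> snd ` walks3 v" if z: "z \<in> {v} \<union> E `` {v} \<union> snd ` walks2 v" for z
  proof
    assume "z \<in> snd ` walks3 v"
    then obtain x y where xy: "(v, x) \<in> E" "(x, y) \<in> E" "y \<noteq> v" "(y, z) \<in> E" "z \<noteq> x"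
      by (auto simp: mem_ends3)
    from z consider "z = v" | "(v, z) \<in> E" | x' where "(v, x') \<in> E" "(x', z) \<in> E" "z \<noteq> v"
      unfolding Un_iff mem_ends2 by auto
    then show False
    proof cases
      case 1
      then show ?thesis using xy no_triangle by blast
    next
      case 2
      then show ?thesis using xy no_square[of v x y z] adj_sym by blast
    next
      case 3
      have "y \<noteq> x'" using 3 xy no_triangle[of v x y] adj_sym by blast
      moreover have "x' \<noteq> x" using 3 xy no_triangle[of x y z] adj_sym by blast
      ultimately show ?thesis
        using xy no_pentagon[of v x y z x'] 3 adj_sym[OF 3(1)] adj_sym[OF 3(2)] by metis
    qed
  qed
  then have "({v} \<union> E `` {v} \<union> snd ` walks2 v) \<inter> snd ` walks3 v = {}" by blast
  ultimately have "card (near v) = 1 + card (E `` {v}) + card (snd ` walks2 v) + card (snd ` walks3 v)"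
    unfolding near_def using finite_nbrs card_walks(4,5)[OF assms]
    by (simp add: card_Un_disjoint del: Un_insert_left)
  then show ?thesis
    using card_walks[OF assms] cubic[OF assms] card_image[OF inj_on_walks2] card_image[OF inj_on_walks3]
    by simp
qed

lemma near_subset: "v \<in> V \<Longrightarrow> near v \<subseteq> V"
  using E_sub by (auto simp: near_def walks2_def walks3_def)

lemma order_ge_22: "V \<noteq> {} \<Longrightarrow> 22 \<le> card V"
  using card_near near_subset card_mono[OF finite_V] by (metis ex_in_conv)

lemma even_order: "even (card V)"
proof -
  have "finite E" using finite_V E_sub by (meson finite_SigmaI finite_subset)
  then have "even (card E)" using sym irrefl by (rule even_card_symmetric)
  moreover have "E = (SIGMA v:V. E `` {v})" using E_sub by auto
  then have "card E = 3 * card V"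
    using card_Sigma_const[OF finite_V, of "\<lambda>v. E `` {v}" 3] cubic by simp
  ultimately show ?thesis by simp
qed

definition heptagons :: "'a list set" where
  "heptagons = {xs. cyclic_list E xs \<and> length xs = 7}"

lemma heptagonE:
  assumes "xs \<in> heptagons"
  obtains a b c d e f g where "xs = [a, b, c, d, e, f, g]" "cyclic_list E [a, b, c, d, e, f, g]"
  using assms by (auto simp: heptagons_def length_Suc_conv numeral_eq_Suc)

lemma dvd_card_heptagons: "7 dvd card heptagons"
proof (rule dvd_card_rotation_closed)
  have "set xs \<subseteq> V" if "xs \<in> heptagons" for xs
    using that E_sub by (fastforce simp: heptagons_def cyclic_list_def in_set_conv_nth)
  then have "heptagons \<subseteq> {xs. set xs \<subseteq> V \<and> length xs = 7}"
    by (auto simp: heptagons_def)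
  then show "finite heptagons"
    using finite_lists_length_eq[OF finite_V] finite_subset by blast
next
  show "rotate1 xs \<in> heptagons" if "xs \<in> heptagons" for xs
    using that by (simp add: heptagons_def cyclic_list_rotate1)
next
  show "distinct xs \<and> length xs = 7" if "xs \<in> heptagons" for xs
    using that by (simp add: heptagons_def cyclic_list_def)
qed simp

text \<open>
  If all vertices are near \<open>v\<close>, the end \<open>d\<close> of a walk of length 4 also ends a walk of length at most
  3 from \<open>v\<close>.  Together the two walks close up to a cycle, which has length 7 only if the
  second walk has length 3; the shorter possibilities contradict the girth.
\<close>

lemma close_walk4:
  assumes near: "near v = V" and w: "(((a, b), c), d) \<in> walks4 v"
  obtains e f where "cyclic_list E [v, a, b, c, d, e, f]"
proof -
  have E: "(v, a) \<in> E" "(a, b) \<in> E" "(b, c) \<in> E" "(c, d) \<in> E" "b \<noteq> v" "c \<noteq> a" "d \<noteq> b"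
    using w by (auto simp: mem_walks)
  have cv: "c \<noteq> v" and da: "d \<noteq> a" using E no_triangle by blast+
  have "d \<in> near v" using E(4) E_sub near by auto
  then consider "d = v" | "(v, d) \<in> E" | x where "(v, x) \<in> E" "(x, d) \<in> E" "d \<noteq> v"
    | f e where "(v, f) \<in> E" "(f, e) \<in> E" "e \<noteq> v" "(e, d) \<in> E" "d \<noteq> f"
    unfolding near_def Un_iff mem_ends2 mem_ends3 by auto
  then show thesis
  proof cases
    case 1
    then show ?thesis using E no_square[of v a b c] by blast
  next
    case 2
    then show ?thesis using E cv da no_pentagon[of v a b c d] adj_sym by blast
  next
    case 3
    have "x \<noteq> a" using 3 E no_square[of a b c d] adj_sym by blast
    moreover have "x \<noteq> c" using 3 E no_square[of v a b c] adj_sym by blast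
    ultimately show ?thesis using 3 E no_hexagon[of v a b c d x] cv da adj_sym by blast
  next
    case 4
    have "c \<noteq> e"
    proof
      assume "c = e"
      moreover have "b \<noteq> f" using 4(1) E no_triangle[of v a b] adj_sym by blast
      moreover have "f \<noteq> a" using 4(2) E no_triangle[of a b c] adj_sym \<open>c = e\<close> by blast
      ultimately show False
        using E 4 cv no_pentagon[of v a b c f] adj_sym[OF 4(1)] adj_sym[OF 4(2)] by metis
    qed
    moreover have "f \<noteq> a"
    proof
      assume "f = a"
      moreover have "e \<noteq> b" using 4(4) E no_triangle[of b c d] adj_sym by blast
      ultimately show False
        using E 4 da \<open>c \<noteq> e\<close> no_pentagon[of a b c d e] adj_sym[OF 4(2)] adj_sym[OF 4(4)] by metis
    qed
    ultimately have "cyclic_list E [v, a, b, c, d, e, f]"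
      using 4 E by (intro cyclic_heptagonI) (auto intro: adj_sym)
    then show ?thesis by (rule that)
  qed
qed

text \<open>
  The first five vertices of a heptagon form a walk of length 4.  Conversely such a walk extends to a
  heptagon by \<open>close_walk4\<close>, and uniquely so because the remaining three edges, read backwards,
  are a walk of length 3 from \<open>v\<close> to \<open>d\<close>.
\<close>

lemma card_heptagons:
  assumes near: "\<And>v. v \<in> V \<Longrightarrow> near v = V"
  shows "card heptagons = 24 * card V"
proof -
  define g :: "'a list \<Rightarrow> 'a \<times> ((('a \<times> 'a) \<times> 'a) \<times> 'a)"
    where "g xs = (xs ! 0, (((xs ! 1, xs ! 2), xs ! 3), xs ! 4))" for xs
  have "bij_betw g heptagons (SIGMA v:V. walks4 v)"
  proof (rule bij_betw_imageI)
    show "inj_on g heptagons"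
    proof (rule inj_onI)
      fix xs ys
      assume "xs \<in> heptagons" "ys \<in> heptagons" and eq: "g xs = g ys"
      then obtain v a b c d e f e' f' where xs: "xs = [v, a, b, c, d, e, f]"
        "cyclic_list E [v, a, b, c, d, e, f]" and ys: "ys = [v, a, b, c, d, e', f']"
        "cyclic_list E [v, a, b, c, d, e', f']"
        by (elim heptagonE) (auto simp: g_def)
      have "((f, e), d) \<in> walks3 v" "((f', e'), d) \<in> walks3 v"
        using cyclic_heptagonD[OF xs(2)] cyclic_heptagonD[OF ys(2)] by (auto simp: mem_walks adj_sym)
      then have "((f, e), d) = ((f', e'), d)"
        by (intro inj_onD[OF inj_on_walks3]) auto
      then show "xs = ys" using xs(1) ys(1) by simp
    qed
    show "g ` heptagons = (SIGMA v:V. walks4 v)"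
    proof (intro equalityI subsetI)
      fix t assume "t \<in> g ` heptagons"
      then obtain v a b c d e f where t: "t = (v, (((a, b), c), d))"
        and cyc: "cyclic_list E [v, a, b, c, d, e, f]"
        by (auto simp: g_def elim!: heptagonE)
      show "t \<in> (SIGMA v:V. walks4 v)"
        using cyclic_heptagonD[OF cyc] E_sub unfolding t by (auto simp: mem_walks)
    next
      fix t assume "t \<in> (SIGMA v:V. walks4 v)"
      then obtain v a b c d where t: "t = (v, (((a, b), c), d))" and v: "v \<in> V"
        and w: "(((a, b), c), d) \<in> walks4 v"
        by (cases t) auto
      obtain e f where "cyclic_list E [v, a, b, c, d, e, f]"
        using close_walk4[OF near[OF v] w] .
      then have "[v, a, b, c, d, e, f] \<in> heptagons" by (simp add: heptagons_def)
      moreover have "g [v, a, b, c, d, e, f] = t" by (simp add: g_def t)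
      ultimately show "t \<in> g ` heptagons" by (metis imageI)
    qed
  qed
  then have "card heptagons = card (SIGMA v:V. walks4 v)" by (rule bij_betw_same_card)
  also have "\<dots> = 24 * card V"
    by (rule card_Sigma_const) (auto simp: finite_V card_walks)
  finally show ?thesis .
qed

text \<open>Here 7 would have to divide \<open>24 * 22 = 528\<close>, which leaves remainder 3.\<close>

lemma order_neq_22: "card V \<noteq> 22"
proof
  assume card: "card V = 22"
  then have "near v = V" if "v \<in> V" for v
    using card_near[OF that] near_subset[OF that] finite_V by (metis card_subset_eq)
  then have "7 dvd 24 * (22::nat)"
    using card_heptagons dvd_card_heptagons card by metis
  then show False by simp
qed

lemma order_bound: "V \<noteq> {} \<Longrightarrow> even (card V) \<and> 24 \<le> card V"
proof -
  assume "V \<noteq> {}"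
  then have "22 < card V" using order_ge_22 order_neq_22 by fastforce
  moreover have "card V \<noteq> 23" using even_order by auto
  ultimately show ?thesis using even_order by simp
qed

end

section \<open>Graphs on residues given by offsets\<close>

text \<open>
  The entries are pairs of the end point of a walk over the integers and its last offset, which is 0
  for the empty walk.  A step is rejected as backtracking if \<open>N\<close> divides the sum of the last two
  offsets.  For \<open>N = 0\<close> this rejects only sums equal to 0 and does not involve the order
  \<open>n\<close>; \<open>N = n\<close> rejects all steps that backtrack modulo \<open>n\<close>, and this is necessary if
  some offset is its own inverse modulo \<open>n\<close>.
\<close>

primrec nbwalks :: "(int \<Rightarrow> int list) \<Rightarrow> int \<Rightarrow> int \<Rightarrow> nat \<Rightarrow> (int \<times> int) list" where
  "nbwalks D N r 0 = [(r, 0)]"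
| "nbwalks D N r (Suc k) =
    concat (map (\<lambda>(y, d). map (\<lambda>e. (y + e, e)) (filter (\<lambda>e. \<not> N dvd d + e) (D y))) (nbwalks D N r k))"

lemma mem_nbwalks_Suc: "(z, e) \<in> set (nbwalks D N r (Suc k)) \<longleftrightarrow>
    (\<exists>y d. (y, d) \<in> set (nbwalks D N r k) \<and> e \<in> set (D y) \<and> \<not> N dvd d + e \<and> z = y + e)"
  by (auto simp: image_iff split_beta Bex_def)

text \<open>
  The reversal condition makes adjacency symmetric, and the incongruence of the offsets
  makes the three neighbours of a vertex different.
\<close>

locale offset_graph =
  fixes n :: nat and c N :: int and D :: "int \<Rightarrow> int list"
  assumes n_pos: "0 < n"
    and c_pos: "0 < c"
    and c_dvd: "c dvd int n"
    and n_dvd: "int n dvd N"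
    and periodic: "D (x mod c) = D x"
    and distinct_offsets: "distinct (D x)"
    and three_offsets: "length (D x) = 3"
    and offsets_incong: "d \<in> set (D x) \<Longrightarrow> e \<in> set (D x) \<Longrightarrow> [d = e] (mod int n) \<Longrightarrow> d = e"
    and no_zero_offset: "d \<in> set (D x) \<Longrightarrow> \<not> int n dvd d"
    and reverse_offset: "d \<in> set (D x) \<Longrightarrow> \<exists>e \<in> set (D (x + d)). int n dvd d + e"
begin

definition graph :: "nat pair_pre_digraph" where
  "graph = \<lparr>pverts = {..<n},
     parcs = {(u, v). u < n \<and> v < n \<and> (\<exists>d \<in> set (D (int u)). [int v = int u + d] (mod int n))}\<rparr>"

lemma pverts_graph [simp]: "pverts graph = {..<n}"
  by (simp add: graph_def)

lemma mem_parcs_graph: "(u, v) \<in> parcs graph \<longleftrightarrow>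
    u < n \<and> v < n \<and> (\<exists>d \<in> set (D (int u)). [int v = int u + d] (mod int n))"
  by (simp add: graph_def)

lemma offsets_cong:
  assumes "[x = y] (mod c)"
  shows "D x = D y"
  using assms by (metis cong_def periodic)

lemma cong_c: "[x = y] (mod int n) \<Longrightarrow> [x = y] (mod c)"
  by (rule cong_dvd_modulus[OF _ c_dvd])

definition vertex :: "int \<Rightarrow> nat" where
  "vertex x = nat (x mod int n)"

lemma vertex_less: "vertex x < n"
  using n_pos by (simp add: vertex_def nat_less_iff)

lemma int_vertex: "int (vertex x) = x mod int n"
  using n_pos by (simp add: vertex_def)

lemma vertex_int: "v < n \<Longrightarrow> vertex (int v) = v"
  by (simp add: vertex_def)

lemma vertex_arc:
  assumes "d \<in> set (D x)"
  shows "(vertex x, vertex (x + d)) \<in> parcs graph"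
proof -
  have "D (int (vertex x)) = D x"
    by (intro offsets_cong cong_c) (simp add: int_vertex cong_def)
  then show ?thesis
    using assms by (auto simp: mem_parcs_graph vertex_less int_vertex cong_def mod_add_left_eq)
qed

lemma sym_parcs: "sym (parcs graph)"
proof (rule symI)
  fix u v assume "(u, v) \<in> parcs graph"
  then obtain d where d: "u < n" "v < n" "d \<in> set (D (int u))" "[int v = int u + d] (mod int n)"
    by (auto simp: mem_parcs_graph)
  obtain e where e: "e \<in> set (D (int u + d))" "int n dvd d + e"
    using reverse_offset[OF d(3)] by blast
  have "e \<in> set (D (int v))" using e(1) offsets_cong[OF cong_c[OF d(4)]] by simp
  moreover have "[int v + e = int u + d + e] (mod int n)"
    using d(4) by (simp add: cong_add)
  then have "[int u = int v + e] (mod int n)"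
    using e(2) by (metis add.assoc add.right_neutral cong_0_iff cong_add_lcancel cong_sym cong_trans)
  ultimately show "(v, u) \<in> parcs graph" using d by (auto simp: mem_parcs_graph)
qed

lemma no_loop: "(u, u) \<notin> parcs graph"
  using no_zero_offset
  by (auto simp: mem_parcs_graph) (metis add.right_neutral cong_0_iff cong_add_lcancel cong_sym)

lemma pair_graph: "pair_graph graph"
proof unfold_locales
  show "finite (parcs graph)"
    by (rule finite_subset[of _ "{..<n} \<times> {..<n}"]) (auto simp: mem_parcs_graph)
qed (use sym_parcs no_loop in \<open>auto simp: mem_parcs_graph symmetric_def\<close>)

lemma regular: "regular 3 graph"
proof -
  have "card (out_arcs (with_proj graph) u) = 3" if u: "u < n" for u
  proof -
    have "out_arcs (with_proj graph) u = (\<lambda>d. (u, vertex (int u + d))) ` set (D (int u))"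
    proof (intro equalityI subsetI)
      fix a assume "a \<in> out_arcs (with_proj graph) u"
      then obtain v where a: "a = (u, v)" "(u, v) \<in> parcs graph"
        by (cases a) (auto simp: out_arcs_def)
      then obtain d where d: "v < n" "d \<in> set (D (int u))" "[int v = int u + d] (mod int n)"
        by (auto simp: mem_parcs_graph)
      then have "vertex (int u + d) = v"
        using vertex_int[of v] by (simp add: vertex_def cong_def)
      then show "a \<in> (\<lambda>d. (u, vertex (int u + d))) ` set (D (int u))" using a d by blast
    qed (use vertex_arc vertex_int u in \<open>fastforce simp: out_arcs_def\<close>)
    moreover have "inj_on (\<lambda>d. (u, vertex (int u + d))) (set (D (int u)))"
    proof (rule inj_onI)
      fix d e assume de: "d \<in> set (D (int u))" "e \<in> set (D (int u))"
        and "(u, vertex (int u + d)) = (u, vertex (int u + e))"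
      then have "(int u + d) mod int n = (int u + e) mod int n" by (metis int_vertex prod.inject)
      then have "[d = e] (mod int n)" by (metis cong_add_lcancel cong_def)
      then show "d = e" using de offsets_incong by blast
    qed
    ultimately show ?thesis
      by (simp add: card_image distinct_card distinct_offsets three_offsets)
  qed
  then show ?thesis by (simp add: regular_def out_degree_def)
qed

text \<open>
  The walk \<open>x\<close> in the graph is lifted to the integers starting at \<open>r\<close>, which need only agree with
  \<open>x 0\<close> modulo \<open>c\<close>: the available offsets stay the same under this shift.  That is why finitely many
  starting points suffice in \<open>no_short_cycle\<close> below.
\<close>

lemma nbwalks_lift:
  fixes x :: "nat \<Rightarrow> int"
  assumes r: "[x 0 = r] (mod c)"
    and step: "\<And>i. i < k \<Longrightarrow> \<exists>d \<in> set (D (x i)). [x (Suc i) = x i + d] (mod int n)"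
    and nonback: "\<And>i. Suc i < k \<Longrightarrow> \<not> [x (Suc (Suc i)) = x i] (mod int n)"
  shows "\<exists>(y, d) \<in> set (nbwalks D N r k). [y - r = x k - x 0] (mod int n) \<and>
    (case k of 0 \<Rightarrow> d = 0 | Suc j \<Rightarrow> [d = x k - x j] (mod int n))"
  using step nonback
proof (induction k)
  case (Suc k)
  then obtain y d where yd: "(y, d) \<in> set (nbwalks D N r k)"
    "[y - r = x k - x 0] (mod int n)" "case k of 0 \<Rightarrow> d = 0 | Suc j \<Rightarrow> [d = x k - x j] (mod int n)"
    by fastforce
  obtain e where e: "e \<in> set (D (x k))" "[x (Suc k) = x k + e] (mod int n)"
    using Suc.prems(1)[of k] by blast
  have "[(y - r) + r = (x k - x 0) + x 0] (mod c)"
    using cong_c[OF yd(2)] cong_sym[OF r] by (rule cong_add)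
  then have eD: "e \<in> set (D y)" using e(1) offsets_cong[of y "x k"] by simp
  have e': "[e = x (Suc k) - x k] (mod int n)"
    using cong_diff[OF cong_sym[OF e(2)] cong_refl[of "x k"]] by simp
  have "\<not> N dvd d + e"
  proof
    assume "N dvd d + e"
    then have dvd: "int n dvd d + e" using n_dvd by (rule dvd_trans[rotated])
    show False
    proof (cases k)
      case 0
      then show False using yd(3) dvd no_zero_offset[OF e(1)] by simp
    next
      case (Suc j)
      then have "[d + e = (x k - x j) + (x (Suc k) - x k)] (mod int n)"
        using yd(3) e' by (intro cong_add) simp_all
      then have "int n dvd x (Suc k) - x j"
        using dvd by (simp add: cong_dvd_iff)
      then show False
        using Suc.prems(2)[of j] Suc by (simp add: cong_iff_dvd_diff)
    qed
  qed
  then have "(y + e, e) \<in> set (nbwalks D N r (Suc k))"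
    using yd(1) eD unfolding mem_nbwalks_Suc by blast
  moreover have "[y + e - r = x (Suc k) - x 0] (mod int n)"
    using cong_add[OF yd(2) e'] by (simp add: algebra_simps)
  ultimately show ?case using e' by (intro bexI[of _ "(y + e, e)"]) simp_all
qed simp

lemma no_short_cycle:
  assumes check: "\<And>r k y d. 0 \<le> r \<Longrightarrow> r < c \<Longrightarrow> 3 \<le> k \<Longrightarrow> k < g \<Longrightarrow>
      (y, d) \<in> set (nbwalks D N r k) \<Longrightarrow> \<not> int n dvd y - r"
    and cyc: "cyclic_list (parcs graph) xs" and len: "3 \<le> length xs"
  shows "g \<le> length xs"
proof (rule ccontr)
  assume short: "\<not> g \<le> length xs"
  let ?L = "length xs"
  define x where "x i = int (xs ! (i mod ?L))" for i
  have arc: "(xs ! (i mod ?L), xs ! (Suc i mod ?L)) \<in> parcs graph" for i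
  proof -
    have "i mod ?L < ?L" using len by (intro mod_less_divisor) linarith
    then show ?thesis using cyc unfolding cyclic_list_def by (metis mod_Suc_eq)
  qed
  then have less: "xs ! (i mod ?L) < n" for i
    by (auto simp: mem_parcs_graph)
  have step: "\<exists>d \<in> set (D (x i)). [x (Suc i) = x i + d] (mod int n)" for i
    using arc[of i] by (auto simp: mem_parcs_graph x_def)
  have nonback: "\<not> [x (Suc (Suc i)) = x i] (mod int n)" for i
  proof
    assume "[x (Suc (Suc i)) = x i] (mod int n)"
    then have "xs ! (Suc (Suc i) mod ?L) = xs ! (i mod ?L)"
      using less by (simp add: x_def cong_def)
    moreover have "0 < ?L" using len by linarith
    ultimately have "Suc (Suc i) mod ?L = i mod ?L"
      using cyc by (metis cyclic_list_def mod_less_divisor nth_eq_iff_index_eq)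
    then have "?L dvd 2"
      by (metis add_2_eq_Suc' mod_eq_dvd_iff_nat diff_add_inverse le_add1)
    then show False using len dvd_imp_le[of ?L 2] by simp
  qed
  have "[x 0 = x 0 mod c] (mod c)" by (simp add: cong_def)
  from nbwalks_lift[OF this step nonback, of ?L]
  obtain y d where y: "(y, d) \<in> set (nbwalks D N (x 0 mod c) ?L)"
    "[y - x 0 mod c = x ?L - x 0] (mod int n)" by blast
  have "x ?L = x 0" unfolding x_def by simp
  then have "int n dvd y - x 0 mod c" using y(2) by (simp add: cong_0_iff)
  then show False
    using check[OF _ _ len _ y(1)] short c_pos by simp
qed

lemma reach_offset:
  assumes "(vertex 0, vertex x) \<in> (parcs graph)\<^sup>*" "d \<in> set (D x)"
  shows "(vertex 0, vertex (x + d)) \<in> (parcs graph)\<^sup>*"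
  using assms vertex_arc by (meson rtrancl.rtrancl_into_rtrancl)

lemma connected:
  assumes "\<And>v. v < n \<Longrightarrow> (vertex 0, v) \<in> (parcs graph)\<^sup>*"
  shows "connected (with_proj graph)"
proof -
  interpret G: pair_graph graph by (rule pair_graph)
  have to: "vertex 0 \<rightarrow>\<^sup>*\<^bsub>with_proj graph\<^esub> v" if "v < n" for v
    using assms[OF that]
  proof (induction rule: rtrancl_induct)
    case base
    then show ?case by (simp add: G.reachable_refl vertex_less)
  next
    case (step y z)
    then show ?case by (metis G.reachable_adj_trans with_proj_simps(3))
  qed
  have "u \<rightarrow>\<^sup>*\<^bsub>with_proj graph\<^esub> v" if "u < n" "v < n" for u v
    using to[OF that(1)] to[OF that(2)] G.reachable_trans G.symmetric_reachable' by metis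
  moreover have "(parcs graph)\<^sup>s = parcs graph"
    using sym_parcs by (auto simp: symcl_def dest: symD)
  ultimately show ?thesis
    using n_pos by (auto simp: connected_conv reachable_def)
qed

lemma mem_kg_spectrum:
  assumes check: "\<And>r k y d. 0 \<le> r \<Longrightarrow> r < c \<Longrightarrow> 3 \<le> k \<Longrightarrow> k < g \<Longrightarrow>
      (y, d) \<in> set (nbwalks D N r k) \<Longrightarrow> \<not> int n dvd y - r"
    and conn: "\<And>v. v < n \<Longrightarrow> (vertex 0, v) \<in> (parcs graph)\<^sup>*"
    and cyc: "cyclic_list (parcs graph) xs" "length xs = g" and "3 \<le> g"
  shows "n \<in> kg_spectrum 3 g"
proof -
  have "girth graph = enat g"
    unfolding girth_eq_iff[OF pair_graph \<open>3 \<le> g\<close>]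
  proof (intro conjI allI impI)
    show "\<exists>xs. cyclic_list (parcs graph) xs \<and> length xs = g" using cyc by blast
    show "g \<le> length ys" if "cyclic_list (parcs graph) ys" "3 \<le> length ys" for ys
      using check that by (rule no_short_cycle)
  qed
  then have "kg_graph 3 g graph" using pair_graph regular by (simp add: kg_graph_def)
  then show ?thesis
    using connected[OF conn] by (auto simp: kg_spectrum_def intro!: exI[of _ graph])
qed

end

section \<open>I-graphs and the McGee graph\<close>

lemma dvd_small_int: "int n dvd z \<Longrightarrow> \<bar>z\<bar> < int n \<Longrightarrow> z = 0"
  using dvd_imp_le_int[of z "int n"] by fastforce

text \<open>
  The offsets of the I-graph \<open>I(m, j, k)\<close> of order \<open>n = 2 * m\<close>: the vertices \<open>2 * q\<close> and \<open>2 * q + 1\<close> are the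
  \<open>q\<close>-th outer and the \<open>q\<close>-th inner vertex, joined by a spoke.  For \<open>j = 1\<close> it is a generalised
  Petersen graph.
\<close>

definition igraph_offsets :: "int \<Rightarrow> int \<Rightarrow> int \<Rightarrow> int list" where
  "igraph_offsets j k x = (if even x then [2 * j, - 2 * j, 1] else [2 * k, - 2 * k, - 1])"

lemma offset_graph_igraph:
  assumes "even n" "26 \<le> n" and jk: "(j, k) = (2, 3) \<or> (j, k) = (1, 4)"
  shows "offset_graph n 2 0 (igraph_offsets j k)"
proof
  have n: "26 \<le> int n" using assms by simp
  fix x d e :: int
  show "(2::int) dvd int n" using assms by simp
  show "igraph_offsets j k (x mod 2) = igraph_offsets j k x"
    by (simp add: igraph_offsets_def)
  show "distinct (igraph_offsets j k x)" "length (igraph_offsets j k x) = 3"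
    using jk by (auto simp: igraph_offsets_def)
  show "\<not> int n dvd d" if "d \<in> set (igraph_offsets j k x)"
  proof
    assume "int n dvd d"
    moreover have "\<bar>d\<bar> < int n" "d \<noteq> 0"
      using that jk n by (auto simp: igraph_offsets_def split: if_splits)
    ultimately show False using dvd_small_int by blast
  qed
  show "d = e" if "d \<in> set (igraph_offsets j k x)" "e \<in> set (igraph_offsets j k x)"
    "[d = e] (mod int n)"
  proof -
    have "\<bar>d - e\<bar> < int n"
      using that(1,2) jk n by (auto simp: igraph_offsets_def split: if_splits)
    then show ?thesis using that(3) dvd_small_int[of n "d - e"] by (simp add: cong_iff_dvd_diff)
  qed
  show "\<exists>e \<in> set (igraph_offsets j k (x + d)). int n dvd d + e"
    if "d \<in> set (igraph_offsets j k x)"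
    using that jk by (auto simp: igraph_offsets_def split: if_splits)
qed (use assms in auto)

text \<open>
  All displacements of lifted non-backtracking walks of length 3 to 6.  The walk closes up modulo \<open>n\<close>
  if and only if \<open>n\<close> divides its displacement.
\<close>

definition nbwalk_displacements :: "(int \<Rightarrow> int list) \<Rightarrow> int \<Rightarrow> int \<Rightarrow> int list" where
  "nbwalk_displacements D N c =
     concat (map (\<lambda>r. concat (map (\<lambda>k. map (\<lambda>(y, d). y - r) (nbwalks D N r k)) [3, 4, 5, 6])) [0..c - 1])"

lemma nbwalk_displacementsI:
  assumes "0 \<le> r" "r < c" "3 \<le> k" "k < 7" "(y, d) \<in> set (nbwalks D N r k)"
  shows "y - r \<in> set (nbwalk_displacements D N c)"
proof -
  have "set (nbwalk_displacements D N c) =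
      (\<Union>r\<in>set [0..c - 1]. \<Union>k\<in>set [3, 4, 5, 6]. (\<lambda>(y, d). y - r) ` set (nbwalks D N r k))"
    by (simp only: nbwalk_displacements_def set_concat set_map image_image)
  moreover have "k \<in> set [3, 4, 5, 6]" using assms(3,4) by auto
  moreover have "r \<in> set [0..c - 1]" using assms(1,2) by simp
  moreover have "y - r \<in> (\<lambda>(y, d). y - r) ` set (nbwalks D N r k)" using assms(5) by force
  ultimately show ?thesis by blast
qed

text \<open>
  Odd displacements are harmless because the orders are even.  The displacements 30 and 36 come from
  walking 5 or 6 times along the offset 6; they are multiples of an even \<open>n \<ge> 26\<close> only if \<open>n\<close> is
  30 or 36.
\<close>

lemma igraph_2_3_displacements:
  "list_all (\<lambda>z. odd z \<or> z \<noteq> 0 \<and> (\<bar>z\<bar> < 26 \<or> \<bar>z\<bar> = 30 \<or> \<bar>z\<bar> = 36))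
     (nbwalk_displacements (igraph_offsets 2 3) 0 2)"
  by code_simp

lemma igraph_1_4_displacements:
  "list_all (\<lambda>z. \<not> 30 dvd z \<and> \<not> 36 dvd z) (nbwalk_displacements (igraph_offsets 1 4) 0 2)"
  by code_simp

text \<open>
  The McGee graph in LCF notation is \<open>[12, 7, -7]\<close> repeated 8 times: a Hamiltonian cycle
  \<open>0, 1, \<dots>, 23\<close> with chords of these lengths.  The chord 12 is its own inverse modulo 24, so
  backtracking has to be recognised modulo 24.
\<close>

definition mcgee_offsets :: "int \<Rightarrow> int list" where
  "mcgee_offsets x =
     (if x mod 3 = 0 then [1, -1, 12] else if x mod 3 = 1 then [1, -1, 7] else [1, -1, -7])"

lemma mcgee_displacements:
  "list_all (\<lambda>z. \<not> 24 dvd z) (nbwalk_displacements mcgee_offsets 24 3)"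
  by code_simp

lemma offset_graph_mcgee: "offset_graph 24 3 24 mcgee_offsets"
proof
  fix x d e :: int
  show "distinct (mcgee_offsets x)" "length (mcgee_offsets x) = 3"
    by (simp_all add: mcgee_offsets_def)
  show "\<not> int 24 dvd d" if "d \<in> set (mcgee_offsets x)"
    using that by (auto simp: mcgee_offsets_def split: if_splits)
  show "d = e" if "d \<in> set (mcgee_offsets x)" "e \<in> set (mcgee_offsets x)" "[d = e] (mod int 24)"
    using that by (auto simp: mcgee_offsets_def cong_def split: if_splits)
  show "\<exists>e \<in> set (mcgee_offsets (x + d)). int 24 dvd d + e" if "d \<in> set (mcgee_offsets x)"
  proof -
    have "x mod 3 = 0 \<or> x mod 3 = 1 \<or> x mod 3 = 2" by presburger
    then consider "x mod 3 = 0" | "x mod 3 = 1" | "x mod 3 = 2" by blast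
    then show ?thesis
    proof cases
      case 1
      then have "(x + 1) mod 3 = 1" "(x - 1) mod 3 = 2" "(x + 12) mod 3 = 0" by presburger+
      then show ?thesis using 1 that by (auto simp: mcgee_offsets_def)
    next
      case 2
      then have "(x + 1) mod 3 = 2" "(x - 1) mod 3 = 0" "(x + 7) mod 3 = 2" by presburger+
      then show ?thesis using 2 that by (auto simp: mcgee_offsets_def)
    next
      case 3
      then have "(x + 1) mod 3 = 0" "(x - 1) mod 3 = 1" "(x - 7) mod 3 = 1" by presburger+
      then show ?thesis using 3 that by (auto simp: mcgee_offsets_def)
    qed
  qed
qed (auto simp: mcgee_offsets_def)

lemma igraph_mem_kg_spectrum:
  assumes "even n" "26 \<le> n"
  shows "n \<in> kg_spectrum 3 7"
proof -
  have n: "26 \<le> int n" "even (int n)" using assms by simp_all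
  define jk :: "int \<times> int" where "jk = (if n = 30 \<or> n = 36 then (1, 4) else (2, 3))"
  obtain j k where jk': "jk = (j, k)" by fastforce
  then have jk: "(j, k) = (2, 3) \<or> (j, k) = (1, 4)" by (auto simp: jk_def split: if_splits)
  interpret offset_graph n 2 0 "igraph_offsets j k"
    using offset_graph_igraph[OF assms jk] .
  let ?R = "\<lambda>x. (vertex 0, vertex x) \<in> (parcs graph)\<^sup>*"
  \<comment> \<open>For \<open>(2, 3)\<close>, cross to the inner rim, move 3 places on, cross back and move 2 places back.\<close>
  have even_step: "?R (x + 2)" if "?R x" "even x" for x
    using jk
  proof
    assume "(j, k) = (1, 4)"
    then show ?thesis using reach_offset[OF that(1), of 2] that(2) by (simp add: igraph_offsets_def)
  next
    assume jk: "(j, k) = (2, 3)"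
    have "?R (x + 1)"
      using reach_offset[OF that(1), of 1] that(2) jk by (simp add: igraph_offsets_def)
    from reach_offset[OF this, of 6] have "?R (x + 1 + 6)"
      using that(2) jk by (simp add: igraph_offsets_def)
    from reach_offset[OF this, of "- 1"] have "?R (x + 1 + 6 + - 1)"
      using that(2) jk by (simp add: igraph_offsets_def)
    from reach_offset[OF this, of "- 4"] have "?R (x + 1 + 6 + - 1 + - 4)"
      using that(2) jk by (simp add: igraph_offsets_def)
    then show ?thesis by (simp add: algebra_simps)
  qed
  have even_reach: "?R (2 * int q)" for q
  proof (induction q)
    case (Suc q)
    then show ?case using even_step[of "2 * int q"] by (simp add: algebra_simps)
  qed simp
  show ?thesis
  proof (rule mem_kg_spectrum)
    fix v assume "v < n"
    have "?R (int v)"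
    proof (cases "even v")
      case True
      then have "2 * int (v div 2) = int v" by presburger
      then show ?thesis using even_reach[of "v div 2"] by simp
    next
      case False
      have "?R (2 * int (v div 2) + 1)"
        by (rule reach_offset[OF even_reach]) (simp add: igraph_offsets_def)
      moreover have "2 * int (v div 2) + 1 = int v" using False by presburger
      ultimately show ?thesis by simp
    qed
    then show "(vertex 0, v) \<in> (parcs graph)\<^sup>*" using vertex_int[OF \<open>v < n\<close>] by simp
  next
    fix r y d :: int and m :: nat
    assume "0 \<le> r" "r < 2" "3 \<le> m" "m < 7" "(y, d) \<in> set (nbwalks (igraph_offsets j k) 0 r m)"
    then have mem: "y - r \<in> set (nbwalk_displacements (igraph_offsets j k) 0 2)"
      by (rule nbwalk_displacementsI)
    show "\<not> int n dvd y - r"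
    proof (cases "n = 30 \<or> n = 36")
      case True
      then have "j = 1" "k = 4" using jk' by (auto simp: jk_def)
      then have "\<not> 30 dvd y - r \<and> \<not> 36 dvd y - r"
        using mem igraph_1_4_displacements unfolding list_all_iff by blast
      moreover have "int n = 30 \<or> int n = 36" using True by auto
      ultimately show ?thesis by metis
    next
      case False
      then have "j = 2" "k = 3" using jk' by (auto simp: jk_def)
      then have z: "odd (y - r) \<or> y - r \<noteq> 0 \<and>
          (\<bar>y - r\<bar> < 26 \<or> \<bar>y - r\<bar> = 30 \<or> \<bar>y - r\<bar> = 36)"
        using mem igraph_2_3_displacements unfolding list_all_iff by blast
      show ?thesis
      proof
        assume dvd: "int n dvd y - r"
        then have "even (y - r)" using n(2) dvd_trans by blast
        then have nz: "y - r \<noteq> 0" and abs: "\<bar>y - r\<bar> < 26 \<or> \<bar>y - r\<bar> = 30 \<or> \<bar>y - r\<bar> = 36"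
          using z by auto
        have "\<not> \<bar>y - r\<bar> < int n" using dvd_small_int[OF dvd] nz by blast
        moreover have "\<bar>y - r\<bar> - int n = 0"
          using dvd abs n(1) calculation by (intro dvd_small_int[of n]) auto
        ultimately show False using abs n(1) False by auto
      qed
    qed
  next
    \<comment> \<open>The 7-cycles express \<open>3 * 2 - 2 * 3 = 0\<close> and \<open>4 * 1 - 1 * 4 = 0\<close>, together with two spokes.\<close>
    show "cyclic_list (parcs graph)
        (if (j, k) = (2, 3) then [0, 4, 8, 12, 13, 7, 1] else [0, 2, 4, 6, 8, 9, 1])"
      using assms jk
      by (auto simp: cyclic_list_def All_less_Suc2 mem_parcs_graph igraph_offsets_def)
  qed auto
qed

lemma mcgee_mem_kg_spectrum: "24 \<in> kg_spectrum 3 7"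
proof -
  interpret offset_graph 24 3 24 mcgee_offsets by (rule offset_graph_mcgee)
  show ?thesis
  proof (rule mem_kg_spectrum)
    fix v :: nat assume "v < 24"
    have "(vertex 0, vertex (int w)) \<in> (parcs graph)\<^sup>*" for w
    proof (induction w)
      case (Suc w)
      have "1 \<in> set (mcgee_offsets (int w))" by (simp add: mcgee_offsets_def)
      from reach_offset[OF Suc this] show ?case by (simp add: add.commute)
    qed simp
    then show "(vertex 0, v) \<in> (parcs graph)\<^sup>*" using vertex_int[OF \<open>v < 24\<close>] by metis
  next
    fix r y d :: int and m :: nat
    assume "0 \<le> r" "r < 3" "3 \<le> m" "m < 7" "(y, d) \<in> set (nbwalks mcgee_offsets 24 r m)"
    then have "y - r \<in> set (nbwalk_displacements mcgee_offsets 24 3)" by (rule nbwalk_displacementsI)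
    then show "\<not> int 24 dvd y - r" using mcgee_displacements unfolding list_all_iff by simp
  next
    show "cyclic_list (parcs graph) [0, 12, 13, 14, 7, 8, 1]"
      by (simp add: cyclic_list_def All_less_Suc2 mem_parcs_graph mcgee_offsets_def)
  qed auto
qed

section \<open>The spectrum\<close>

lemma kg_spectrum_3_7_lower:
  assumes "n \<in> kg_spectrum 3 7"
  shows "even n \<and> 24 \<le> n"
proof -
  obtain G :: "nat pair_pre_digraph" where G: "pair_graph G" "regular 3 G" "girth G = enat 7"
    and n: "card (pverts G) = n"
    using assms by (auto simp: kg_spectrum_def kg_graph_def)
  interpret pair_graph G by fact
  note girth = girth_eq_iff[OF G(1), of 7, THEN iffD1, simplified, OF G(3)[simplified]]
  have "cubic_girth_ge_7 (pverts G) (parcs G)"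
  proof
    show "sym (parcs G)" using sym_arcs by (simp add: symmetric_def)
    show "irrefl (parcs G)" using pair_no_loops by (force simp: irrefl_def)
    fix v assume "v \<in> pverts G"
    then have "card (out_arcs (with_proj G) v) = 3"
      using G(2) by (simp add: regular_def out_degree_def)
    moreover have "out_arcs (with_proj G) v = Pair v ` (parcs G `` {v})"
      by (auto simp: out_arcs_def)
    ultimately show "card (parcs G `` {v}) = 3" by (simp add: card_image inj_on_def)
  qed (use girth pair_finite_verts in \<open>auto dest: in_arcsD1 in_arcsD2\<close>)
  moreover have "pverts G \<noteq> {}"
  proof -
    obtain xs where "cyclic_list (parcs G) xs" "length xs = 7" using girth by blast
    then have "(xs ! 0, xs ! 1) \<in> parcs G"
      unfolding cyclic_list_def by (auto dest: spec[of _ 0])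
    then show ?thesis using in_arcsD1 by blast
  qed
  ultimately show ?thesis using cubic_girth_ge_7.order_bound n by blast
qed

theorem mainTheorem2:
  shows "kg_spectrum 3 7 = {n. even n \<and> 24 \<le> n}
    \<and> (LEAST n. n \<in> kg_spectrum 3 7) = 24
    \<and> spectrum_N 3 7 = 24
    \<and> moore_bound 3 7 < 24"
proof (intro conjI)
  have "n \<in> kg_spectrum 3 7" if "even n" "24 \<le> n" for n
  proof (cases "n = 24")
    case False
    then have "26 \<le> n" using that by presburger
    then show ?thesis using that(1) by (rule igraph_mem_kg_spectrum[rotated])
  qed (use mcgee_mem_kg_spectrum in simp)
  then show spec: "kg_spectrum 3 7 = {n. even n \<and> 24 \<le> n}"
    using kg_spectrum_3_7_lower by blast
  show "(LEAST n. n \<in> kg_spectrum 3 7) = 24"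
    unfolding spec by (rule Least_equality) auto
  show "spectrum_N 3 7 = 24"
    unfolding spectrum_N_def spec by (rule Least_equality) auto
  show "moore_bound 3 7 < 24"
  proof -
    have "{0..2::nat} = {0, 1, 2}" by auto
    then show ?thesis by (simp add: moore_bound_def)
  qed
qed

end
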